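(* Let $p\colon Q\to[0,\tfrac12]$ be defined by $p([q,q'])=|\operatorname{Im}(x\,\overline{x'})|$ for $(q,q')\in V$, $q=(x,y)$, $q'=(x',y')$. Then the orbits of $G$ in $Q$ are the fibres of $p$: 1. $p^{-1}(\{0\})=G\cdot P_1=\{P\in Q:\ (x,x')\text{ is linearly dependent over }\mathbb{R}\}$; 2. $p^{-1}(\{\tfrac12\})=G\cdot P_2=\{P\in Q:\ \langle x,x'\rangle=|x'|-|x|=0\}$; 3. $p^{-1}(\,]0,\tfrac12[\,)=U$, and for all $P,P'\in U$, $p(P)=p(P')\Longleftrightarrow G\cdot P=G\cdot P'$.
   Context: $\mathbb{H}$ denotes the quaternions, $\operatorname{Im}$ the imaginary part of a quaternion, $S^3$ the unit quaternions, $L_c(x)=cx$, $R_a(x)=xa$ on $\mathbb{H}$. $\mathbb{O}=\mathbb{H}^2=\mathbb{R}^8$ with its Euclidean structure, $S^7$ its unit sphere. For $q=(x,y)$, $q'=(x',y')$, $B(q,q')=x\overline{x'}+y'\overline{y}\in\mathbb{H}$, and $V=\{(q,q')\in S^7\times S^7: B(q,q')=0\}$ (pairs in $V$ are orthonormal). $[q,q']$ denotes the oriented plane with oriented orthonormal basis $(q,q')$ and $Q=\{[q,q']:(q,q')\in V\}$. For $P\in Q$ we write $P=[q,q']$ with $(q,q')\in V$, $q=(x,y)$, $q'=(x',y')$; the stated conditions and the value of $p$ do not depend on the choice of $(q,q')$. $G=\{g\in SO(8): \forall q,q',\ B(q,q')=0\Leftrightarrow B(gq,gq')=0\}$ acts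 on $Q$ by $g\cdot[q,q']=[gq,gq']$; explicitly $G=G^0\sqcup L_{E^\downarrow}G^0$, where $G^0=\{(x,y)\mapsto(cxa,cyb): a,b,c\in S^3\}$ and $L_{E^\downarrow}(x,y)=(-y,x)$. $P_1=[(1,0),(0,1)]$, $P_2=\left[\left(\tfrac1{\sqrt2},\tfrac{i}{\sqrt2}\right),\left(\tfrac{-i}{\sqrt2},\tfrac1{\sqrt2}\right)\right]$, and $U=\{P\in Q:\ (x,x')\text{ linearly independent over }\mathbb{R}\text{ and }|\langle x,x'\rangle|+||x|-|x'||\neq0\}$. *)

theory Defs
  imports "HOL-Analysis.Analysis"
begin

section \<open>Quaternions\<close>

datatype quat = Quat (qRe: real) (qI: real) (qJ: real) (qK: real)

lemma quat_eq_iff: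
  "x = y \<longleftrightarrow> qRe x = qRe y \<and> qI x = qI y \<and> qJ x = qJ y \<and> qK x = qK y"
  by (cases x; cases y) auto

lemma quat_eqI:
  "\<lbrakk>qRe x = qRe y; qI x = qI y; qJ x = qJ y; qK x = qK y\<rbrakk> \<Longrightarrow> x = y"
  by (simp add: quat_eq_iff)

instantiation quat :: ring_1
begin

definition "0 = Quat 0 0 0 0"
definition "1 = Quat 1 0 0 0"
definition "x + y = Quat (qRe x + qRe y) (qI x + qI y) (qJ x + qJ y) (qK x + qK y)"
definition "x - y = Quat (qRe x - qRe y) (qI x - qI y) (qJ x - qJ y) (qK x - qK y)"
definition "- x = Quat (- qRe x) (- qI x) (- qJ x) (- qK x)"
definition "x * y = Quat
  (qRe x * qRe y - qI x * qI y - qJ x * qJ y - qK x * qK y)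
  (qRe x * qI y + qI x * qRe y + qJ x * qK y - qK x * qJ y)
  (qRe x * qJ y - qI x * qK y + qJ x * qRe y + qK x * qI y)
  (qRe x * qK y + qI x * qJ y - qJ x * qI y + qK x * qRe y)"

instance
  by standard
    (auto simp: zero_quat_def one_quat_def plus_quat_def minus_quat_def uminus_quat_def
      times_quat_def algebra_simps)

end

lemma quat_sel_ring [simp]:
  "qRe 0 = 0" "qI 0 = 0" "qJ 0 = 0" "qK 0 = 0"
  "qRe 1 = 1" "qI 1 = 0" "qJ 1 = 0" "qK 1 = 0"
  "qRe (x + y) = qRe x + qRe y" "qI (x + y) = qI x + qI y"
  "qJ (x + y) = qJ x + qJ y" "qK (x + y) = qK x + qK y"
  "qRe (x - y) = qRe x - qRe y" "qI (x - y) = qI x - qI y"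
  "qJ (x - y) = qJ x - qJ y" "qK (x - y) = qK x - qK y"
  "qRe (- x) = - qRe x" "qI (- x) = - qI x" "qJ (- x) = - qJ x" "qK (- x) = - qK x"
  by (simp_all add: zero_quat_def one_quat_def plus_quat_def minus_quat_def uminus_quat_def)

lemma quat_sel_mult [simp]:
  "qRe (x * y) = qRe x * qRe y - qI x * qI y - qJ x * qJ y - qK x * qK y"
  "qI (x * y) = qRe x * qI y + qI x * qRe y + qJ x * qK y - qK x * qJ y"
  "qJ (x * y) = qRe x * qJ y - qI x * qK y + qJ x * qRe y + qK x * qI y"
  "qK (x * y) = qRe x * qK y + qI x * qJ y - qJ x * qI y + qK x * qRe y"
  by (simp_all add: times_quat_def)

instantiation quat :: real_algebra_1
begin

definition "scaleR r x = Quat (r * qRe x) (r * qI x) (r * qJ x) (r * qK x)"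

instance
  by standard (auto simp: scaleR_quat_def quat_eq_iff algebra_simps)

end

lemma quat_sel_scaleR [simp]:
  "qRe (r *\<^sub>R x) = r * qRe x" "qI (r *\<^sub>R x) = r * qI x"
  "qJ (r *\<^sub>R x) = r * qJ x" "qK (r *\<^sub>R x) = r * qK x"
  by (simp_all add: scaleR_quat_def)

instantiation quat :: real_inner
begin

definition "inner x y = qRe x * qRe y + qI x * qI y + qJ x * qJ y + qK x * qK y"
definition norm_quat_def: "norm (x::quat) = sqrt (inner x x)"
definition sgn_quat_def: "sgn (x::quat) = x /\<^sub>R norm x"
definition dist_quat_def: "dist x y = norm (x - y :: quat)"
definition uniformity_quat_def [code del]:
  "(uniformity :: (quat \<times> quat) filter) = (INF e\<in>{0 <..}. principal {(x, y). dist x y < e})"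
definition open_quat_def [code del]:
  "open (U :: quat set) \<longleftrightarrow> (\<forall>x\<in>U. eventually (\<lambda>(x', y). x' = x \<longrightarrow> y \<in> U) uniformity)"

instance
proof
  fix r :: real and x y z :: quat and U :: "quat set"
  show "inner x y = inner y x" "inner (x + y) z = inner x z + inner y z"
    "inner (r *\<^sub>R x) y = r * inner x y" "0 \<le> inner x x"
    by (simp_all add: inner_quat_def algebra_simps)
  show "inner x x = 0 \<longleftrightarrow> x = 0"
  proof -
    have "inner x x = ((qRe x)\<^sup>2 + (qI x)\<^sup>2) + ((qJ x)\<^sup>2 + (qK x)\<^sup>2)"
      by (simp add: inner_quat_def power2_eq_square)
    moreover have "\<dots> = 0 \<longleftrightarrow> (qRe x)\<^sup>2 + (qI x)\<^sup>2 = 0 \<and> (qJ x)\<^sup>2 + (qK x)\<^sup>2 = 0"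
      by (rule add_nonneg_eq_0_iff) simp_all
    ultimately show ?thesis by (simp add: quat_eq_iff)
  qed
qed (rule norm_quat_def sgn_quat_def dist_quat_def uniformity_quat_def open_quat_def)+

end

declare uniformity_Abort[where 'a = quat, code]

definition qcnj :: "quat \<Rightarrow> quat" where
  "qcnj x = Quat (qRe x) (- qI x) (- qJ x) (- qK x)"

lemma qcnj_sel [simp]:
  "qRe (qcnj x) = qRe x" "qI (qcnj x) = - qI x" "qJ (qcnj x) = - qJ x" "qK (qcnj x) = - qK x"
  by (simp_all add: qcnj_def)

definition qIm :: "quat \<Rightarrow> quat" where
  "qIm x = Quat 0 (qI x) (qJ x) (qK x)"

lemma qIm_sel [simp]:
  "qRe (qIm x) = 0" "qI (qIm x) = qI x" "qJ (qIm x) = qJ x" "qK (qIm x) = qK x"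
  by (simp_all add: qIm_def)

lemma quat_mult_cnj: "x * qcnj x = inner x x *\<^sub>R 1" "qcnj x * x = inner x x *\<^sub>R 1"
  by (simp_all add: quat_eq_iff inner_quat_def)

instantiation quat :: real_normed_div_algebra
begin

definition "inverse (x::quat) = qcnj x /\<^sub>R inner x x"
definition "x div (y::quat) = x * inverse y"

instance
proof
  fix x y :: quat
  show "inverse x * x = 1" "x * inverse x = 1" if "x \<noteq> 0"
    using that by (simp_all add: inverse_quat_def quat_mult_cnj)
  show "x div y = x * inverse y" by (rule divide_quat_def)
  show "inverse (0::quat) = 0" by (simp add: inverse_quat_def)
  show "norm (x * y) = norm x * norm y"
    unfolding norm_quat_def real_sqrt_mult [symmetric] inner_quat_def
    by (rule arg_cong[where f = sqrt]) (simp add: algebra_simps)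
qed

end

instantiation quat :: euclidean_space
begin

definition "Basis = {Quat 1 0 0 0, Quat 0 1 0 0, Quat 0 0 1 0, Quat 0 0 0 1}"

instance
proof
  show "(Basis :: quat set) \<noteq> {}" "finite (Basis :: quat set)"
    by (simp_all add: Basis_quat_def)
  show "inner u v = (if u = v then 1 else 0)" if "u \<in> Basis" "v \<in> Basis" for u v :: quat
    using that unfolding Basis_quat_def inner_quat_def insert_iff empty_iff
    by (elim disjE; simp)
  show "(\<forall>u\<in>Basis. inner x u = 0) \<longleftrightarrow> x = 0" for x :: quat
    unfolding Basis_quat_def inner_quat_def quat_eq_iff by simp
qed

end

abbreviation quat_i :: quat where
  "quat_i \<equiv> Quat 0 1 0 0"


section \<open>The form on pairs of quaternions\<close>

type_synonym oct = "quat \<times> quat"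

definition Bform :: "oct \<Rightarrow> oct \<Rightarrow> quat" where
  "Bform q q' = fst q * qcnj (fst q') + snd q' * qcnj (snd q)"

definition V :: "(oct \<times> oct) set" where
  "V = {(q, q'). q \<in> sphere 0 1 \<and> q' \<in> sphere 0 1 \<and> Bform q q' = 0}"

lemma qRe_Bform: "qRe (Bform q q') = inner q q'"
  by (cases q; cases q') (simp add: Bform_def inner_quat_def)

lemma V_orthonormal:
  assumes "(q, q') \<in> V"
  shows "inner q q = 1" "inner q' q' = 1" "inner q q' = 0"
  using assms qRe_Bform[of q q'] by (auto simp: V_def norm_eq_1)


section \<open>Oriented planes\<close>

text \<open>An oriented plane is represented by the set of all its positively oriented bases.\<close>

definition oplane :: "'a::real_vector \<Rightarrow> 'a \<Rightarrow> ('a \<times> 'a) set" where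
  "oplane q q' = {(a *\<^sub>R q + b *\<^sub>R q', c *\<^sub>R q + d *\<^sub>R q') | a b c d. a * d - b * c > 0}"

lemma oplane_self: "(q, q') \<in> oplane q q'"
  unfolding oplane_def by (rule CollectI, rule exI[of _ 1], rule exI[of _ 0],
    rule exI[of _ 0], rule exI[of _ 1]) simp

text \<open>Positively oriented orthonormal bases of the same plane differ by a rotation.\<close>

lemma oplane_eq_rotation:
  fixes q q' r r' :: "'a::real_inner"
  assumes on: "inner q q = 1" "inner q' q' = 1" "inner q q' = 0"
    and on': "inner r r = 1" "inner r' r' = 1" "inner r r' = 0"
    and eq: "oplane q q' = oplane r r'"
  obtains c s where "c\<^sup>2 + s\<^sup>2 = (1::real)"
    "r = c *\<^sub>R q + s *\<^sub>R q'" "r' = - s *\<^sub>R q + c *\<^sub>R q'"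
proof -
  have "(r, r') \<in> oplane q q'" using eq oplane_self by simp
  then obtain a b c d where r: "r = a *\<^sub>R q + b *\<^sub>R q'" "r' = c *\<^sub>R q + d *\<^sub>R q'"
    and pos: "a * d - b * c > 0"
    unfolding oplane_def by blast
  have qq: "inner q' q = 0" using on(3) by (simp add: inner_commute)
  have 1: "a\<^sup>2 + b\<^sup>2 = 1" using on' on qq unfolding r
    by (simp add: inner_add_left inner_add_right power2_eq_square)
  have 2: "c\<^sup>2 + d\<^sup>2 = 1" using on' on qq unfolding r
    by (simp add: inner_add_left inner_add_right power2_eq_square)
  have 3: "a * c + b * d = 0" using on' on qq unfolding r
    by (simp add: inner_add_left inner_add_right mult.commute)
  have "(a * d - b * c)\<^sup>2 = (a\<^sup>2 + b\<^sup>2) * (c\<^sup>2 + d\<^sup>2) - (a * c + b * d)\<^sup>2" by algebra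
  then have "(a * d - b * c)\<^sup>2 = 1" using 1 2 3 by simp
  then have det: "a * d - b * c = 1" using pos by (simp add: power2_eq_1_iff)
  have "(a - d)\<^sup>2 + (b + c)\<^sup>2 = (a\<^sup>2 + b\<^sup>2) + (c\<^sup>2 + d\<^sup>2) - 2 * (a * d - b * c)" by algebra
  then have "(a - d)\<^sup>2 + (b + c)\<^sup>2 = 0" using 1 2 det by simp
  then have "d = a" "c = - b" by (auto simp: sum_power2_eq_zero_iff)
  then show ?thesis using that[of a b] 1 r by simp
qed

definition Q :: "(oct \<times> oct) set set" where
  "Q = {oplane q q' | q q'. (q, q') \<in> V}"

lemma V_oplane_eq_rotation:
  assumes "(q, q') \<in> V" "(r, r') \<in> V" "oplane q q' = oplane r r'"
  obtains c s where "c\<^sup>2 + s\<^sup>2 = (1::real)"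
    "r = c *\<^sub>R q + s *\<^sub>R q'" "r' = - s *\<^sub>R q + c *\<^sub>R q'"
  using oplane_eq_rotation[OF V_orthonormal[OF assms(1)] V_orthonormal[OF assms(2)] assms(3)]
  by blast


section \<open>The function \<open>p\<close>\<close>

definition p :: "(oct \<times> oct) set \<Rightarrow> real" where
  "p P = (THE t. \<exists>q q'. (q, q') \<in> V \<and> P = oplane q q' \<and> t = norm (qIm (fst q * qcnj (fst q'))))"

lemma p_oplane:
  assumes "(q, q') \<in> V"
  shows "p (oplane q q') = norm (qIm (fst q * qcnj (fst q')))"
  unfolding p_def
proof (rule the_equality)
  fix t
  assume "\<exists>r r'. (r, r') \<in> V \<and> oplane q q' = oplane r r' \<and> t = norm (qIm (fst r * qcnj (fst r')))"
  then obtain r r' where rr: "(r, r') \<in> V" "oplane q q' = oplane r r'"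
    and t: "t = norm (qIm (fst r * qcnj (fst r')))" by blast
  obtain c s where cs: "c\<^sup>2 + s\<^sup>2 = (1::real)"
    and r: "r = c *\<^sub>R q + s *\<^sub>R q'" "r' = - s *\<^sub>R q + c *\<^sub>R q'"
    using V_oplane_eq_rotation[OF assms rr] by blast
  have "qIm (fst r * qcnj (fst r')) = (c\<^sup>2 + s\<^sup>2) *\<^sub>R qIm (fst q * qcnj (fst q'))"
    unfolding r by (simp add: quat_eq_iff, intro conjI; algebra)
  then show "t = norm (qIm (fst q * qcnj (fst q')))" using cs t by simp
qed (use assms in blast)


section \<open>The group \<open>G\<close> and its action on oriented planes\<close>

definition coords8 :: "oct \<Rightarrow> real^8" where
  "coords8 = (\<lambda>(x, y). vector [qRe x, qI x, qJ x, qK x, qRe y, qI y, qJ y, qK y])"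

lemma UNIV_8: "(UNIV :: 8 set) = {1, 2, 3, 4, 5, 6, 7, 8}"
proof -
  have "i \<in> {1, 2, 3, 4, 5, 6, 7, 8}" for i :: 8
  proof (induct i)
    case (of_int z)
    then have "z \<in> {0, 1, 2, 3, 4, 5, 6, 7}" by auto
    then show ?case by auto
  qed
  then show ?thesis by blast
qed

lemma coords8_nth [simp]:
  "coords8 (x, y) $ 1 = qRe x" "coords8 (x, y) $ 2 = qI x"
  "coords8 (x, y) $ 3 = qJ x" "coords8 (x, y) $ 4 = qK x"
  "coords8 (x, y) $ 5 = qRe y" "coords8 (x, y) $ 6 = qI y"
  "coords8 (x, y) $ 7 = qJ y" "coords8 (x, y) $ 8 = qK y"
  unfolding coords8_def vector_def by simp_all

lemma sum_8: "(\<Sum>i\<in>UNIV. f i) = f 1 + f 2 + f 3 + f 4 + f 5 + f 6 + f 7 + f (8::8)"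
  unfolding UNIV_8 by (simp add: add.assoc)

lemma inner_coords8: "inner (coords8 q) (coords8 q') = inner q q'"
  by (cases q; cases q') (simp only: inner_vec_def sum_8 coords8_nth inner_prod_def
      inner_quat_def inner_real_def fst_conv snd_conv add.assoc)

definition SO8 :: "(oct \<Rightarrow> oct) set" where
  "SO8 = {g. \<exists>A :: real^8^8. orthogonal_matrix A \<and> det A = 1 \<and>
             (\<forall>q. coords8 (g q) = A *v coords8 q)}"

definition G :: "(oct \<Rightarrow> oct) set" where
  "G = {g \<in> SO8. \<forall>q q'. Bform q q' = 0 \<longleftrightarrow> Bform (g q) (g q') = 0}"

definition act :: "('a \<Rightarrow> 'a) \<Rightarrow> ('a \<times> 'a) set \<Rightarrow> ('a \<times> 'a) set" where
  "act g P = map_prod g g ` P"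

lemma act_oplane:
  assumes "linear g"
  shows "act g (oplane q q') = oplane (g q) (g q')"
proof -
  have *: "map_prod g g (a *\<^sub>R q + b *\<^sub>R q', c *\<^sub>R q + d *\<^sub>R q')
      = (a *\<^sub>R g q + b *\<^sub>R g q', c *\<^sub>R g q + d *\<^sub>R g q')" for a b c d
    by (simp add: linear_add[OF assms] linear_scale[OF assms])
  show ?thesis
  proof (intro set_eqI iffI)
    fix w assume "w \<in> act g (oplane q q')"
    then obtain z where "w = map_prod g g z" "z \<in> oplane q q'"
      unfolding act_def by (rule imageE)
    then show "w \<in> oplane (g q) (g q')"
      unfolding oplane_def mem_Collect_eq using * by metis
  next
    fix w assume "w \<in> oplane (g q) (g q')"
    then obtain a b c d where w: "w = map_prod g g (a *\<^sub>R q + b *\<^sub>R q', c *\<^sub>R q + d *\<^sub>R q')"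
      and "a * d - b * c > 0"
      unfolding oplane_def mem_Collect_eq * by metis
    then have "(a *\<^sub>R q + b *\<^sub>R q', c *\<^sub>R q + d *\<^sub>R q') \<in> oplane q q'"
      unfolding oplane_def mem_Collect_eq by metis
    with w show "w \<in> act g (oplane q q')"
      unfolding act_def by (rule image_eqI)
  qed
qed

lemma SO8_linear:
  assumes "g \<in> SO8"
  shows "linear g"
proof -
  obtain A :: "real^8^8" where A: "\<And>q. coords8 (g q) = A *v coords8 q"
    using assms by (auto simp: SO8_def)
  have inj: "q = q'" if "coords8 q = coords8 q'" for q q'
    using arg_cong[OF that, of "\<lambda>v. v $ 1"] arg_cong[OF that, of "\<lambda>v. v $ 2"]
      arg_cong[OF that, of "\<lambda>v. v $ 3"] arg_cong[OF that, of "\<lambda>v. v $ 4"]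
      arg_cong[OF that, of "\<lambda>v. v $ 5"] arg_cong[OF that, of "\<lambda>v. v $ 6"]
      arg_cong[OF that, of "\<lambda>v. v $ 7"] arg_cong[OF that, of "\<lambda>v. v $ 8"]
    by (cases q; cases q') (simp add: quat_eq_iff)
  have ext8: "v = w" if "\<And>i. i \<in> {1, 2, 3, 4, 5, 6, 7, 8} \<Longrightarrow> v $ i = w $ i" for v w :: "real^8"
    using that UNIV_8 unfolding vec_eq_iff by blast
  have add: "coords8 (q + q') = coords8 q + coords8 q'" for q q'
    by (rule ext8; cases q; cases q'; elim insertE emptyE; simp)
  have scale: "coords8 (r *\<^sub>R q) = r *\<^sub>R coords8 q" for r q
    by (rule ext8; cases q; elim insertE emptyE; simp)
  show ?thesis
    by (rule linearI; rule inj)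
      (simp_all add: A add scale matrix_vector_right_distrib matrix_vector_mult_scaleR)
qed

lemma G_act_oplane: "g \<in> G \<Longrightarrow> act g (oplane q q') = oplane (g q) (g q')"
  by (simp add: G_def SO8_linear act_oplane)

definition orbit :: "(oct \<times> oct) set \<Rightarrow> (oct \<times> oct) set set" where
  "orbit P = {act g P | g. g \<in> G}"

definition P1 :: "(oct \<times> oct) set" where
  "P1 = oplane (1, 0) (0, 1)"

definition P2 :: "(oct \<times> oct) set" where
  "P2 = oplane ((1 / sqrt 2) *\<^sub>R 1, (1 / sqrt 2) *\<^sub>R quat_i)
               (- (1 / sqrt 2) *\<^sub>R quat_i, (1 / sqrt 2) *\<^sub>R 1)"


section \<open>Conditions on the first components\<close>

text \<open>Linear independence of the family \<open>(x, x')\<close>, not of the set \<open>{x, x'}\<close>: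
  a pair with \<open>x = x'\<close> is dependent.\<close>

definition lin_indep_pair :: "'a::real_vector \<Rightarrow> 'a \<Rightarrow> bool" where
  "lin_indep_pair x x' \<longleftrightarrow> (\<forall>a b. a *\<^sub>R x + b *\<^sub>R x' = 0 \<longrightarrow> a = 0 \<and> b = 0)"

definition U :: "(oct \<times> oct) set set" where
  "U = {oplane q q' | q q'. (q, q') \<in> V \<and> lin_indep_pair (fst q) (fst q') \<and>
          \<bar>inner (fst q) (fst q')\<bar> + \<bar>norm (fst q) - norm (fst q')\<bar> \<noteq> 0}"

text \<open>Linear dependence of \<open>(x, x')\<close> and the condition \<open>\<langle>x, x'\<rangle> = |x'| - |x| = 0\<close> depend only on the
  oriented plane, not on the representative in \<open>V\<close>.\<close>

lemma lin_indep_pair_rotate: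
  assumes "c\<^sup>2 + s\<^sup>2 = (1::real)"
  shows "lin_indep_pair (c *\<^sub>R x + s *\<^sub>R x') (- s *\<^sub>R x + c *\<^sub>R x') \<longleftrightarrow> lin_indep_pair x x'"
    (is "?L \<longleftrightarrow> ?R")
proof
  assume R: ?R
  show ?L unfolding lin_indep_pair_def
  proof (intro allI impI)
    fix a b
    assume "a *\<^sub>R (c *\<^sub>R x + s *\<^sub>R x') + b *\<^sub>R (- s *\<^sub>R x + c *\<^sub>R x') = 0"
    then have "(a * c - b * s) *\<^sub>R x + (a * s + b * c) *\<^sub>R x' = 0"
      by (simp add: algebra_simps)
    then have z: "a * c - b * s = 0" "a * s + b * c = 0"
      using R unfolding lin_indep_pair_def by blast+
    have "a * (c\<^sup>2 + s\<^sup>2) = (a * c - b * s) * c + (a * s + b * c) * s"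
      "b * (c\<^sup>2 + s\<^sup>2) = (a * s + b * c) * c - (a * c - b * s) * s" by algebra+
    then show "a = 0 \<and> b = 0" unfolding z assms by simp
  qed
next
  assume L: ?L
  show ?R unfolding lin_indep_pair_def
  proof (intro allI impI)
    fix a b
    assume 0: "a *\<^sub>R x + b *\<^sub>R x' = 0"
    have "(a * c + b * s) *\<^sub>R (c *\<^sub>R x + s *\<^sub>R x') + (b * c - a * s) *\<^sub>R (- s *\<^sub>R x + c *\<^sub>R x')
        = ((c\<^sup>2 + s\<^sup>2) * a) *\<^sub>R x + ((c\<^sup>2 + s\<^sup>2) * b) *\<^sub>R x'"
      by (simp add: algebra_simps power2_eq_square)
    then have "(a * c + b * s) *\<^sub>R (c *\<^sub>R x + s *\<^sub>R x') + (b * c - a * s) *\<^sub>R (- s *\<^sub>R x + c *\<^sub>R x') = 0"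
      using 0 unfolding assms by simp
    then have z: "a * c + b * s = 0" "b * c - a * s = 0"
      using L unfolding lin_indep_pair_def by blast+
    have "a * (c\<^sup>2 + s\<^sup>2) = (a * c + b * s) * c - (b * c - a * s) * s"
      "b * (c\<^sup>2 + s\<^sup>2) = (b * c - a * s) * c + (a * c + b * s) * s" by algebra+
    then show "a = 0 \<and> b = 0" unfolding z assms by simp
  qed
qed

lemma conformal_rotate:
  fixes x x' :: "'a::real_inner"
  assumes cs: "c\<^sup>2 + s\<^sup>2 = (1::real)" and "inner x x' = 0" "norm x' - norm x = 0"
  defines "w \<equiv> c *\<^sub>R x + s *\<^sub>R x'" and "w' \<equiv> - s *\<^sub>R x + c *\<^sub>R x'"
  shows "inner w w' = 0 \<and> norm w' - norm w = 0"
proof -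
  have z: "inner x x' = 0" "inner x' x = 0" "inner x' x' = inner x x"
    using assms(2,3) by (simp_all add: inner_commute norm_eq)
  have "inner w w' = 0" "inner w' w' = inner w w"
    unfolding w_def w'_def by (simp_all add: inner_add_left inner_add_right inner_diff_left
        inner_diff_right z)
  then show ?thesis by (simp add: norm_eq)
qed

lemma V_lin_indep_pair_well_defined:
  assumes "(q, q') \<in> V" "(r, r') \<in> V" "oplane q q' = oplane r r'"
  shows "lin_indep_pair (fst r) (fst r') \<longleftrightarrow> lin_indep_pair (fst q) (fst q')"
proof -
  obtain c s where "c\<^sup>2 + s\<^sup>2 = (1::real)"
    "r = c *\<^sub>R q + s *\<^sub>R q'" "r' = - s *\<^sub>R q + c *\<^sub>R q'"
    using V_oplane_eq_rotation[OF assms] by blast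
  then show ?thesis
    using lin_indep_pair_rotate[of c s "fst q" "fst q'"] by simp
qed

lemma V_conformal_well_defined:
  assumes "(q, q') \<in> V" "(r, r') \<in> V" "oplane q q' = oplane r r'"
  shows "inner (fst r) (fst r') = 0 \<and> norm (fst r') - norm (fst r) = 0 \<longleftrightarrow>
         inner (fst q) (fst q') = 0 \<and> norm (fst q') - norm (fst q) = 0"
proof -
  have *: "inner (fst w) (fst w') = 0 \<and> norm (fst w') - norm (fst w) = 0"
    if hyp: "(v, v') \<in> V" "(w, w') \<in> V" "oplane v v' = oplane w w'"
      "inner (fst v) (fst v') = 0 \<and> norm (fst v') - norm (fst v) = 0" for v v' w w'
  proof -
    obtain c s where "c\<^sup>2 + s\<^sup>2 = (1::real)"
      "w = c *\<^sub>R v + s *\<^sub>R v'" "w' = - s *\<^sub>R v + c *\<^sub>R v'"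
      using V_oplane_eq_rotation[OF hyp(1-3)] by blast
    then show ?thesis
      using conformal_rotate[of c s "fst v" "fst v'"] hyp(4) by simp
  qed
  show ?thesis using *[OF assms] *[OF assms(2,1) assms(3)[symmetric]] by blast
qed

end

theory Submission
  imports Defs
begin

text \<open>
  The fibres of \<open>p\<close> are orbits for two separate reasons: \<open>p\<close> is invariant under \<open>G\<close>, and every
  plane can be moved into a normal form that depends on \<open>p\<close> only.

  Invariance comes from the property that defines \<open>G\<close>. For a unit vector \<open>q\<close>, \<open>norm (Bform q v)\<close>
  is the distance from \<open>v\<close> to the four-dimensional space \<open>{u. Bform q u = 0}\<close>, which an element of
  \<open>G\<close> carries to the corresponding space at \<open>g q\<close>. As \<open>g\<close> is an isometry,
  \<open>norm (Bform (g q) (g v)) = norm (Bform q v)\<close> (\<open>G_norm_Bform\<close>). On the other hand \<open>p\<close> can be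
  recovered from these norms: for \<open>(q, q')\<close> in \<open>V\<close>, the number \<open>2 * p (oplane q q')\<close> is the
  maximum of \<open>norm (Bform q' w)\<close> over the unit vectors \<open>w\<close> with \<open>norm (Bform q w) = 1\<close>
  (\<open>Bform_commutator_attained\<close>, \<open>Bform_commutator_bound\<close>). Indeed such \<open>w\<close> have the form
  \<open>(qcnj e * x, e * y)\<close> with \<open>norm e = 1\<close>, and \<open>Bform q' w\<close> is then the commutator of \<open>e\<close> with
  \<open>x * qcnj x'\<close>. Its norm is at most twice that of the imaginary part of \<open>x * qcnj x'\<close>, with equality
  when \<open>e\<close> anticommutes with this imaginary part.

  For the normal form, rotate the basis \<open>(q, q')\<close> of the plane until \<open>x\<close> is orthogonal to \<open>x'\<close> and
  \<open>norm x' \<le> norm x\<close>. Then \<open>x * qcnj x'\<close> is purely imaginary, and a map \<open>(c x a, c y b)\<close> brings the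
  basis to \<open>((\<alpha>, \<beta> i), (- \<beta> i, \<alpha>))\<close> with \<open>\<alpha> = norm x\<close> and \<open>\<beta> = norm x'\<close> (\<open>normalise_basis\<close>).
  Since \<open>\<alpha>\<^sup>2 + \<beta>\<^sup>2 = 1\<close> and \<open>\<alpha> \<beta> = p\<close>, the numbers \<open>\<alpha> \<ge> \<beta> \<ge> 0\<close> are determined by \<open>p\<close>.

  The three descriptions of fibres by the first components follow from \<open>x * qcnj x'\<close> being real
  exactly for dependent \<open>x, x'\<close>, and from the identity
  \<open>(|x|\<^sup>2 - |x'|\<^sup>2)\<^sup>2 + 4 \<langle>x, x'\<rangle>\<^sup>2 + 4 p\<^sup>2 = 1\<close> (\<open>V_defect_identity\<close>), which also bounds \<open>p\<close> by \<open>1/2\<close>.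
\<close>

section \<open>Quaternions\<close>

lemma qcnj_mult: "qcnj (x * y) = qcnj y * qcnj x"
  by (simp add: quat_eq_iff algebra_simps)

lemma qcnj_qcnj [simp]: "qcnj (qcnj x) = x"
  by (simp add: quat_eq_iff)

lemma qcnj_zero_iff [simp]: "qcnj x = 0 \<longleftrightarrow> x = 0"
  by (simp add: quat_eq_iff)

lemma qcnj_add: "qcnj (x + y) = qcnj x + qcnj y"
  by (simp add: quat_eq_iff)

lemma qcnj_minus: "qcnj (- x) = - qcnj x"
  by (simp add: quat_eq_iff)

lemma qcnj_diff: "qcnj (x - y) = qcnj x - qcnj y"
  by (simp add: quat_eq_iff)

lemma qcnj_scaleR: "qcnj (r *\<^sub>R x) = r *\<^sub>R qcnj x"
  by (simp add: quat_eq_iff)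

lemma norm_qcnj [simp]: "norm (qcnj x) = norm x"
  by (simp add: norm_quat_def inner_quat_def)

lemma unit_mult_qcnj:
  assumes "norm a = 1"
  shows "a * qcnj a = 1" "qcnj a * a = 1"
  using assms by (simp_all add: quat_mult_cnj norm_eq_1)

lemma unit_cancel:
  assumes "norm a = 1"
  shows "a * (qcnj a * z) = z" "qcnj a * (a * z) = z"
  by (simp_all add: mult.assoc[symmetric] unit_mult_qcnj[OF assms])

lemma qRe_mult_qcnj: "qRe (x * qcnj y) = inner x y"
  by (simp add: inner_quat_def)

lemma norm_qIm_square: "(norm (qIm z))\<^sup>2 = (norm z)\<^sup>2 - (qRe z)\<^sup>2"
  unfolding power2_norm_eq_inner by (simp add: inner_quat_def power2_eq_square)

lemma qIm_eq_self: "qRe z = 0 \<Longrightarrow> qIm z = z"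
  by (simp add: quat_eq_iff)

lemma real_quat: "qIm z = 0 \<Longrightarrow> z = qRe z *\<^sub>R 1"
  by (simp add: quat_eq_iff)

lemma unit_factor:
  fixes x :: quat
  obtains u where "norm u = 1" "x = norm x *\<^sub>R u"
proof (cases "x = 0")
  case True
  then show ?thesis using that[of 1] by simp
next
  case False
  then show ?thesis using that[of "sgn x"] by (simp add: norm_sgn sgn_div_norm)
qed

text \<open>The square root of \<open>c\<close> is the direction of \<open>1 + c\<close>, as for complex numbers; \<open>c = -1\<close>, where
  this direction is undefined, has the root \<open>i\<close>.\<close>

lemma unit_square_root:
  fixes c :: quat
  assumes "norm c = 1"
  obtains d where "norm d = 1" "d * d = c"
proof (cases "c = -1")
  case True
  have "norm quat_i = 1" "quat_i * quat_i = c"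
    by (simp_all add: True norm_quat_def inner_quat_def quat_eq_iff)
  then show ?thesis by (rule that)
next
  case False
  define n where "n = norm (1 + c)"
  have n: "n \<noteq> 0" using False by (simp add: n_def add_eq_0_iff)
  have cc: "inner c c = 1" using assms by (simp add: norm_eq_1)
  have "n\<^sup>2 = 2 + 2 * qRe c"
    using cc by (simp add: n_def power2_norm_eq_inner inner_quat_def algebra_simps)
  moreover have "(1 + c) * (1 + c) = (2 + 2 * qRe c) *\<^sub>R c"
    using cc by (simp add: quat_eq_iff inner_quat_def algebra_simps)
  ultimately have sq: "(1 + c) * (1 + c) = n\<^sup>2 *\<^sub>R c" by simp
  have inv: "inverse n * (inverse n * n\<^sup>2) = 1"
    using n by (simp add: power2_eq_square field_simps)
  show ?thesis
  proof (rule that)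
    show "norm ((1 + c) /\<^sub>R n) = 1" using n by (simp add: n_def)
    show "((1 + c) /\<^sub>R n) * ((1 + c) /\<^sub>R n) = c"
      using inv by (simp add: sq)
  qed
qed

text \<open>Any two imaginary units are conjugate. The identity
  \<open>(-i * e - 1) * e = -i * (-i * e - 1)\<close>, valid because both units square to \<open>-1\<close>, gives the
  conjugating element, unless \<open>-i * e = 1\<close>; then \<open>e = i\<close>, and \<open>j\<close> conjugates \<open>i\<close> to \<open>-i\<close>.\<close>

lemma imaginary_unit_conjugate:
  fixes e :: quat
  assumes e: "norm e = 1" "qRe e = 0"
  obtains c where "norm c = 1" "c * e * qcnj c = - quat_i"
proof -
  have ee: "inner e e = 1" using e by (simp add: norm_eq_1)
  have *: "\<exists>c. norm c = 1 \<and> c * e = - quat_i * c"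
  proof (cases "e = quat_i")
    case True
    show ?thesis
      by (rule exI[of _ "Quat 0 0 1 0"])
        (simp add: True norm_quat_def inner_quat_def quat_eq_iff)
  next
    case False
    define d where "d = - quat_i * e - 1"
    have "d \<noteq> 0" using False by (auto simp: d_def quat_eq_iff e)
    have "d * e = - quat_i * d"
      using ee e by (simp add: d_def quat_eq_iff inner_quat_def algebra_simps)
    with \<open>d \<noteq> 0\<close> show ?thesis
      by (intro exI[of _ "d /\<^sub>R norm d"]) simp
  qed
  then obtain c where c: "norm c = 1" "c * e = - quat_i * c" by blast
  then have "c * e * qcnj c = - quat_i"
    by (simp add: mult.assoc unit_mult_qcnj)
  with c(1) show ?thesis by (rule that)
qed

text \<open>Imaginary quaternions anticommute exactly when they are orthogonal, and a unit orthogonal to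
  \<open>qIm m\<close> is obtained by a quarter turn of its component in the plane of \<open>i\<close> and \<open>j\<close>.\<close>

lemma anticommuting_unit:
  obtains e where "norm e = 1" "e * qIm m = - (qIm m * e)"
proof (cases "qI m = 0 \<and> qJ m = 0")
  case True
  show ?thesis
    by (rule that[of quat_i]) (simp_all add: norm_quat_def inner_quat_def quat_eq_iff True)
next
  case False
  define d where "d = Quat 0 (- qJ m) (qI m) 0"
  have "d \<noteq> 0" using False by (auto simp: d_def quat_eq_iff)
  moreover have "d * qIm m = - (qIm m * d)" by (simp add: d_def quat_eq_iff)
  ultimately show ?thesis by (intro that[of "d /\<^sub>R norm d"]) simp_all
qed


section \<open>The norm of the form as a distance\<close>

lemma inner_oct: "inner q q' = inner (fst q) (fst q') + inner (snd q) (snd q')" for q q' :: oct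
  by (simp add: inner_prod_def)

lemma norm_oct_square: "(norm q)\<^sup>2 = (norm (fst q))\<^sup>2 + (norm (snd q))\<^sup>2" for q :: oct
  by (simp add: power2_norm_eq_inner inner_oct)

lemma Bform_add_right: "Bform q (v + w) = Bform q v + Bform q w"
  by (simp add: Bform_def qcnj_add algebra_simps)

lemma Bform_diff_right: "Bform q (v - w) = Bform q v - Bform q w"
  by (simp add: Bform_def qcnj_diff algebra_simps)

lemma Bform_scaleR_right: "Bform q (r *\<^sub>R v) = r *\<^sub>R Bform q v"
  by (simp add: Bform_def qcnj_scaleR scaleR_add_right)

lemma Bform_add_left: "Bform (v + w) q = Bform v q + Bform w q"
  by (simp add: Bform_def qcnj_add algebra_simps)

lemma Bform_scaleR_left: "Bform (r *\<^sub>R v) q = r *\<^sub>R Bform v q"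
  by (simp add: Bform_def qcnj_scaleR scaleR_add_right)

lemma Bform_commute: "Bform q' q = qcnj (Bform q q')"
  by (simp add: Bform_def qcnj_add qcnj_mult)

lemma Bform_self: "Bform q q = (norm q)\<^sup>2 *\<^sub>R 1"
  by (simp add: Bform_def quat_mult_cnj inner_oct power2_norm_eq_inner scaleR_add_left)

text \<open>The vectors \<open>fibre_point e q\<close>, for fixed \<open>q \<noteq> 0\<close>, form the orthogonal complement of
  \<open>{u. Bform q u = 0}\<close>.\<close>

definition fibre_point :: "quat \<Rightarrow> oct \<Rightarrow> oct" where
  "fibre_point e q = (qcnj e * fst q, e * snd q)"

lemma norm_fibre_point: "norm (fibre_point e q) = norm e * norm q"
  by (rule power2_eq_imp_eq)
    (simp_all add: norm_oct_square fibre_point_def norm_mult power_mult_distrib distrib_left)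

lemma inner_fibre_point: "inner v (fibre_point e q) = inner e (Bform q v)"
  by (simp add: inner_oct fibre_point_def Bform_def inner_quat_def algebra_simps)

lemma Bform_fibre_point: "Bform q (fibre_point e q) = (norm q)\<^sup>2 *\<^sub>R e"
proof -
  have "Bform q (fibre_point e q) = fst q * qcnj (fst q) * e + e * (snd q * qcnj (snd q))"
    by (simp add: Bform_def fibre_point_def qcnj_mult mult.assoc)
  then show ?thesis
    by (simp add: quat_mult_cnj inner_oct power2_norm_eq_inner scaleR_add_left)
qed

lemma norm_Bform_le: "norm (Bform q v) \<le> norm q * norm v"
proof (cases "Bform q v = 0")
  case False
  define b where "b = Bform q v"
  have "norm b * norm b = inner b b" by (simp add: power2_norm_eq_inner[symmetric] power2_eq_square)
  also have "\<dots> = inner v (fibre_point b q)" by (simp add: inner_fibre_point b_def)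
  also have "\<dots> \<le> norm v * norm (fibre_point b q)" by (rule norm_cauchy_schwarz)
  finally have "norm b * norm b \<le> norm b * (norm q * norm v)"
    by (simp add: norm_fibre_point mult_ac)
  then show ?thesis using False by (simp add: b_def)
qed simp

lemma Bform_residual:
  assumes "norm q = 1"
  shows "Bform q (v - fibre_point (Bform q v) q) = 0"
    and "(norm (v - fibre_point (Bform q v) q))\<^sup>2 = (norm v)\<^sup>2 - (norm (Bform q v))\<^sup>2"
proof -
  let ?f = "fibre_point (Bform q v) q"
  show "Bform q (v - ?f) = 0" by (simp add: Bform_diff_right Bform_fibre_point assms)
  have "(norm (v - ?f))\<^sup>2 = (norm v)\<^sup>2 - 2 * inner v ?f + (norm ?f)\<^sup>2"
    by (simp add: power2_norm_eq_inner inner_diff_left inner_diff_right inner_commute)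
  then show "(norm (v - ?f))\<^sup>2 = (norm v)\<^sup>2 - (norm (Bform q v))\<^sup>2"
    by (simp add: inner_fibre_point norm_fibre_point assms power2_norm_eq_inner)
qed


section \<open>The group\<close>

definition decoords8 :: "real^8 \<Rightarrow> oct" where
  "decoords8 v = (Quat (v $ 1) (v $ 2) (v $ 3) (v $ 4), Quat (v $ 5) (v $ 6) (v $ 7) (v $ 8))"

lemma decoords8_coords8 [simp]: "decoords8 (coords8 q) = q"
  by (cases q) (simp add: decoords8_def)

lemma coords8_decoords8 [simp]: "coords8 (decoords8 v) = v"
proof -
  have "coords8 (decoords8 v) $ i = v $ i" for i
  proof -
    have "i \<in> {1, 2, 3, 4, 5, 6, 7, 8}" using UNIV_8 by blast
    then show ?thesis by (elim insertE emptyE; simp add: decoords8_def)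
  qed
  then show ?thesis by (simp add: vec_eq_iff)
qed

lemma linear_decoords8: "linear decoords8"
  by (rule linearI) (simp_all add: decoords8_def quat_eq_iff)

lemma linear_coords8: "linear coords8"
proof (rule linearI)
  show "coords8 (q + q') = coords8 q + coords8 q'" for q q'
    using linear_add[OF linear_decoords8, of "coords8 q" "coords8 q'"]
    by (metis coords8_decoords8 decoords8_coords8)
  show "coords8 (r *\<^sub>R q) = r *\<^sub>R coords8 q" for r q
    using linear_scale[OF linear_decoords8, of r "coords8 q"]
    by (metis coords8_decoords8 decoords8_coords8)
qed

lemma inner_decoords8: "inner (decoords8 v) (decoords8 w) = inner v w"
  using inner_coords8[of "decoords8 v" "decoords8 w"] by simp

lemma SO8_orthogonal_transformation:
  assumes "g \<in> SO8"
  shows "orthogonal_transformation g"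
proof -
  obtain A :: "real^8^8" where A: "orthogonal_matrix A" "\<And>q. coords8 (g q) = A *v coords8 q"
    using assms by (auto simp: SO8_def)
  have "orthogonal_transformation (\<lambda>v. A *v v)"
    unfolding orthogonal_transformation_matrix using A(1) by simp
  then have "inner (A *v coords8 q) (A *v coords8 q') = inner (coords8 q) (coords8 q')" for q q'
    by (simp only: orthogonal_transformation_def)
  then have "inner (g q) (g q') = inner q q'" for q q'
    by (simp only: A(2)[symmetric] inner_coords8)
  with SO8_linear[OF assms] show ?thesis by (simp add: orthogonal_transformation_def)
qed

text \<open>A determinant \<open>\<plusminus>1\<close> becomes \<open>1\<close> after squaring. The maps \<open>(x, y) \<mapsto> (c x a, c y b)\<close> have
  isometric square roots of the same form, hence determinant \<open>1\<close>.\<close>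

lemma orthogonal_square_SO8:
  assumes h: "orthogonal_transformation h"
  shows "h \<circ> h \<in> SO8"
proof -
  define k where "k = (\<lambda>v. coords8 (h (decoords8 v)))"
  have "linear k"
    unfolding k_def using linear_compose[OF linear_compose[OF linear_decoords8
      orthogonal_transformation_linear[OF h]] linear_coords8]
    by (simp add: o_def)
  moreover have "inner (h q) (h q') = inner q q'" for q q'
    using h by (simp only: orthogonal_transformation_def)
  ultimately have k: "orthogonal_transformation k"
    unfolding orthogonal_transformation_def by (simp only: k_def inner_coords8 inner_decoords8) simp
  define B where "B = matrix k"
  have B: "orthogonal_matrix B"
    using k by (simp add: B_def orthogonal_transformation_matrix)
  have Bk: "B *v v = k v" for v
    using matrix_works \<open>linear k\<close> by (simp add: B_def)
  have "orthogonal_matrix (B ** B)" using B by (rule orthogonal_matrix_mul[OF B])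
  moreover have "det (B ** B) = 1"
    using det_orthogonal_matrix[OF B] by (auto simp: det_mul)
  moreover have "coords8 ((h \<circ> h) q) = (B ** B) *v coords8 q" for q
    by (simp add: matrix_vector_mul_assoc[symmetric] Bk k_def)
  ultimately show ?thesis unfolding SO8_def by blast
qed

lemma SO8_comp:
  assumes "g \<in> SO8" "h \<in> SO8"
  shows "g \<circ> h \<in> SO8"
proof -
  obtain A B :: "real^8^8" where
    A: "orthogonal_matrix A" "det A = 1" "\<And>q. coords8 (g q) = A *v coords8 q" and
    B: "orthogonal_matrix B" "det B = 1" "\<And>q. coords8 (h q) = B *v coords8 q"
    using assms by (auto simp: SO8_def)
  have "orthogonal_matrix (A ** B)" "det (A ** B) = 1"
    "\<And>q. coords8 ((g \<circ> h) q) = (A ** B) *v coords8 q"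
    using A B by (simp_all add: orthogonal_matrix_mul det_mul matrix_vector_mul_assoc)
  then show ?thesis unfolding SO8_def by blast
qed

lemma SO8_bij: "g \<in> SO8 \<Longrightarrow> bij g"
  by (rule orthogonal_transformation_bij) (rule SO8_orthogonal_transformation)

lemma SO8_inv:
  assumes "g \<in> SO8"
  shows "inv g \<in> SO8"
proof -
  obtain A :: "real^8^8" where
    A: "orthogonal_matrix A" "det A = 1" "\<And>q. coords8 (g q) = A *v coords8 q"
    using assms by (auto simp: SO8_def)
  have "coords8 (inv g q) = transpose A *v coords8 q" for q
  proof -
    have "coords8 q = A *v coords8 (inv g q)"
      using A(3)[of "inv g q"] SO8_bij[OF assms] by (simp add: bij_is_surj surj_f_inv_f)
    then show ?thesis
      using A(1) by (simp add: matrix_vector_mul_assoc orthogonal_matrix)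
  qed
  moreover have "orthogonal_matrix (transpose A)" "det (transpose A) = 1"
    using A by (simp_all add: orthogonal_matrix_transpose det_transpose)
  ultimately show ?thesis unfolding SO8_def by blast
qed

lemma G_SO8: "g \<in> G \<Longrightarrow> g \<in> SO8"
  by (simp add: G_def)

lemma G_Bform_zero: "g \<in> G \<Longrightarrow> Bform (g q) (g q') = 0 \<longleftrightarrow> Bform q q' = 0"
  unfolding G_def by blast

lemma G_I:
  assumes "g \<in> SO8" "\<And>q q'. Bform (g q) (g q') = 0 \<longleftrightarrow> Bform q q' = 0"
  shows "g \<in> G"
  using assms unfolding G_def by blast

lemma G_comp: "g \<in> G \<Longrightarrow> h \<in> G \<Longrightarrow> g \<circ> h \<in> G"
  by (rule G_I) (simp_all add: SO8_comp G_SO8 G_Bform_zero)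

lemma G_inv_right:
  assumes "g \<in> G"
  shows "g (inv g q) = q"
  using SO8_bij[OF G_SO8[OF assms]] by (simp add: bij_is_surj surj_f_inv_f)

lemma G_inv_left:
  assumes "g \<in> G"
  shows "inv g (g q) = q"
  using SO8_bij[OF G_SO8[OF assms]] by (simp add: bij_is_inj)

lemma G_inv:
  assumes "g \<in> G"
  shows "inv g \<in> G"
proof (rule G_I)
  show "inv g \<in> SO8" by (rule SO8_inv[OF G_SO8[OF assms]])
  show "Bform (inv g q) (inv g q') = 0 \<longleftrightarrow> Bform q q' = 0" for q q'
    using G_Bform_zero[OF assms, of "inv g q" "inv g q'"] by (simp add: G_inv_right[OF assms])
qed

lemma G_norm: "g \<in> G \<Longrightarrow> norm (g q) = norm q"
  using SO8_orthogonal_transformation[OF G_SO8] orthogonal_transformation_norm by blast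

lemma G_V: "g \<in> G \<Longrightarrow> (q, q') \<in> V \<Longrightarrow> (g q, g q') \<in> V"
  by (simp add: V_def G_norm G_Bform_zero)

lemma act_inv_act:
  assumes "g \<in> G"
  shows "act (inv g) (act g P) = P"
proof -
  have "map_prod (inv g) (inv g) \<circ> map_prod g g = id"
    by (simp add: fun_eq_iff G_inv_left[OF assms])
  then show ?thesis unfolding act_def by (simp add: image_comp)
qed

lemma act_comp: "act (g \<circ> h) P = act g (act h P)"
  by (simp add: act_def image_comp map_prod_compose)

lemma two_sided_multiplication_G:
  assumes "norm a = 1" "norm b = 1" "norm c = 1"
  shows "(\<lambda>(x, y). (c * x * a, c * y * b)) \<in> G"
proof -
  let ?g = "\<lambda>(x, y). (c * x * a, c * y * b)"
  obtain a' b' c' where a': "norm a' = 1" "a' * a' = a" and b': "norm b' = 1" "b' * b' = b"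
    and c': "norm c' = 1" "c' * c' = c"
    using assms unit_square_root by metis
  define h where "h = (\<lambda>(x, y). (c' * x * a', c' * y * b'))"
  have "linear h"
    by (rule linearI) (auto simp: h_def algebra_simps)
  moreover have "norm (h q) = norm q" for q
    by (cases q) (simp add: h_def norm_Pair norm_mult a' b' c')
  ultimately have "orthogonal_transformation h" by (simp add: orthogonal_transformation)
  moreover have "h \<circ> h = ?g"
    by (auto simp: fun_eq_iff h_def mult.assoc a'(2)[symmetric] b'(2)[symmetric] c'(2)[symmetric])
  ultimately have "?g \<in> SO8" using orthogonal_square_SO8 by metis
  moreover have "Bform (?g q) (?g q') = c * Bform q q' * qcnj c" for q q'
    by (cases q; cases q')
      (simp add: Bform_def qcnj_mult mult.assoc unit_cancel assms distrib_left distrib_right)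
  moreover have "c \<noteq> 0" using assms by auto
  ultimately show ?thesis by (intro G_I) simp_all
qed


section \<open>Invariance of \<open>p\<close>\<close>

text \<open>The residual \<open>u\<close> of \<open>v\<close> lies in \<open>{u. Bform q u = 0}\<close>, so \<open>Bform (g q)\<close> vanishes on \<open>g u\<close> and
  only \<open>g (v - u)\<close> contributes, whose norm is \<open>norm (Bform q v)\<close>.\<close>

lemma G_norm_Bform_le:
  assumes g: "g \<in> G" and q: "norm q = 1"
  shows "norm (Bform (g q) (g v)) \<le> norm (Bform q v)"
proof -
  define f where "f = fibre_point (Bform q v) q"
  have "Bform (g q) (g (v - f)) = 0"
    using Bform_residual(1)[OF q] G_Bform_zero[OF g] by (simp add: f_def)
  then have "Bform (g q) (g v) = Bform (g q) (g f)"
    by (simp add: linear_diff[OF SO8_linear[OF G_SO8[OF g]]] Bform_diff_right)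
  also have "norm \<dots> \<le> norm f"
    using norm_Bform_le[of "g q" "g f"] by (simp add: G_norm[OF g] q)
  also have "norm f = norm (Bform q v)" by (simp add: f_def norm_fibre_point q)
  finally show ?thesis .
qed

lemma G_norm_Bform:
  assumes g: "g \<in> G" and q: "norm q = 1"
  shows "norm (Bform (g q) (g v)) = norm (Bform q v)"
proof (rule antisym[OF G_norm_Bform_le[OF assms]])
  show "norm (Bform q v) \<le> norm (Bform (g q) (g v))"
    using G_norm_Bform_le[OF G_inv[OF g], of "g q" "g v"] by (simp add: G_norm g q G_inv_left)
qed

lemma V_norm: "(q, q') \<in> V \<Longrightarrow> norm q = 1" "(q, q') \<in> V \<Longrightarrow> norm q' = 1"
  and V_Bform: "(q, q') \<in> V \<Longrightarrow> Bform q q' = 0"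
  by (simp_all add: V_def)

text \<open>Real parts are central, so only the imaginary part of \<open>x * qcnj x'\<close> enters the commutator.\<close>

lemma Bform_commutator:
  assumes "(q, q') \<in> V"
  defines "m \<equiv> qIm (fst q * qcnj (fst q'))"
  shows "Bform q' (fibre_point e q) = e * m - m * e"
proof -
  have "snd q' * qcnj (snd q) = - (fst q * qcnj (fst q'))"
    using V_Bform[OF assms(1)] by (simp add: Bform_def add_eq_0_iff)
  then have "snd q * qcnj (snd q') = - (fst q' * qcnj (fst q))"
    by (metis qcnj_minus qcnj_mult qcnj_qcnj)
  then have "Bform q' (fibre_point e q) = fst q' * qcnj (fst q) * e - e * (fst q' * qcnj (fst q))"
    by (simp add: Bform_def fibre_point_def qcnj_mult mult.assoc)
  also have "\<dots> = qcnj (fst q * qcnj (fst q')) * e - e * qcnj (fst q * qcnj (fst q'))"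
    by (simp add: qcnj_mult)
  also have "\<dots> = e * m - m * e"
    unfolding m_def by (simp add: quat_eq_iff del: quat_sel_mult(1-4)) (simp add: algebra_simps)
  finally show ?thesis .
qed

lemma Bform_commutator_bound:
  assumes V: "(q, q') \<in> V" and w: "norm w = 1" "norm (Bform q w) = 1"
  shows "norm (Bform q' w) \<le> 2 * p (oplane q q')"
proof -
  define e where "e = Bform q w"
  define m where "m = qIm (fst q * qcnj (fst q'))"
  have "norm (w - fibre_point e q) = 0"
    using Bform_residual(2)[OF V_norm(1)[OF V], of w] w by (simp add: e_def)
  then have "w = fibre_point e q" by simp
  then have "Bform q' w = e * m - m * e" using Bform_commutator[OF V] by (simp add: m_def)
  then have "norm (Bform q' w) \<le> norm (e * m) + norm (m * e)" by (simp add: norm_triangle_ineq4)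
  also have "\<dots> = 2 * norm m" using w by (simp add: norm_mult e_def)
  finally show ?thesis by (simp add: p_oplane[OF V] m_def)
qed

lemma Bform_commutator_attained:
  assumes V: "(q, q') \<in> V"
  obtains w where "norm w = 1" "norm (Bform q w) = 1" "norm (Bform q' w) = 2 * p (oplane q q')"
proof -
  define m where "m = qIm (fst q * qcnj (fst q'))"
  obtain e where e: "norm e = 1" "e * m = - (m * e)"
    using anticommuting_unit[of "fst q * qcnj (fst q')"] unfolding m_def by blast
  have "Bform q' (fibre_point e q) = - (2 *\<^sub>R (m * e))"
    using Bform_commutator[OF V, of e] e(2) by (simp add: m_def scaleR_2)
  then have "norm (Bform q' (fibre_point e q)) = 2 * p (oplane q q')"
    by (simp add: norm_mult e(1) p_oplane[OF V] m_def)
  with V_norm[OF V] e show ?thesis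
    by (intro that[of "fibre_point e q"]) (simp_all add: norm_fibre_point Bform_fibre_point)
qed

lemma Q_cases:
  assumes "P \<in> Q"
  obtains q q' where "(q, q') \<in> V" "P = oplane q q'"
  using assms unfolding Q_def by blast

lemma oplane_Q: "(q, q') \<in> V \<Longrightarrow> oplane q q' \<in> Q"
  unfolding Q_def by blast

lemma act_Q: "g \<in> G \<Longrightarrow> P \<in> Q \<Longrightarrow> act g P \<in> Q"
  by (erule Q_cases) (simp add: G_act_oplane G_V oplane_Q)

lemma p_act_ge:
  assumes g: "g \<in> G" and "P \<in> Q"
  shows "p P \<le> p (act g P)"
proof -
  obtain q q' where V: "(q, q') \<in> V" and P: "P = oplane q q'" using assms(2) by (rule Q_cases)
  obtain w where w: "norm w = 1" "norm (Bform q w) = 1" "norm (Bform q' w) = 2 * p P"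
    using Bform_commutator_attained[OF V] unfolding P by blast
  have "norm (Bform (g q') (g w)) \<le> 2 * p (oplane (g q) (g q'))"
    by (rule Bform_commutator_bound[OF G_V[OF g V]])
      (simp_all add: G_norm[OF g] G_norm_Bform[OF g] V_norm[OF V] w)
  then show ?thesis
    by (simp add: P G_act_oplane[OF g] G_norm_Bform[OF g] V_norm[OF V] w(3)[unfolded P])
qed

lemma p_act:
  assumes "g \<in> G" "P \<in> Q"
  shows "p (act g P) = p P"
  using p_act_ge[OF assms] p_act_ge[OF G_inv[OF assms(1)] act_Q[OF assms]]
  by (simp add: act_inv_act[OF assms(1)])


section \<open>Transitivity on the fibres\<close>

lemma oplane_rotate_subset:
  assumes "c\<^sup>2 + s\<^sup>2 = (1::real)"
  shows "oplane (c *\<^sub>R q + s *\<^sub>R q') (- s *\<^sub>R q + c *\<^sub>R q') \<subseteq> oplane q q'"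
proof
  fix z assume "z \<in> oplane (c *\<^sub>R q + s *\<^sub>R q') (- s *\<^sub>R q + c *\<^sub>R q')"
  then obtain a b a' b' where pos: "a * b' - b * a' > 0" and
    z: "z = (a *\<^sub>R (c *\<^sub>R q + s *\<^sub>R q') + b *\<^sub>R (- s *\<^sub>R q + c *\<^sub>R q'),
             a' *\<^sub>R (c *\<^sub>R q + s *\<^sub>R q') + b' *\<^sub>R (- s *\<^sub>R q + c *\<^sub>R q'))"
    unfolding oplane_def by blast
  have "z = ((a * c - b * s) *\<^sub>R q + (a * s + b * c) *\<^sub>R q',
             (a' * c - b' * s) *\<^sub>R q + (a' * s + b' * c) *\<^sub>R q')"
    unfolding z by (simp add: algebra_simps)
  moreover have "(a * c - b * s) * (a' * s + b' * c) - (a * s + b * c) * (a' * c - b' * s)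
      = (a * b' - b * a') * (c\<^sup>2 + s\<^sup>2)" by algebra
  then have "(a * c - b * s) * (a' * s + b' * c) - (a * s + b * c) * (a' * c - b' * s) > 0"
    using pos by (simp add: assms)
  ultimately show "z \<in> oplane q q'" unfolding oplane_def by blast
qed

lemma oplane_rotate:
  assumes "c\<^sup>2 + s\<^sup>2 = (1::real)"
  shows "oplane (c *\<^sub>R q + s *\<^sub>R q') (- s *\<^sub>R q + c *\<^sub>R q') = oplane q q'"
proof
  let ?r = "c *\<^sub>R q + s *\<^sub>R q'" and ?r' = "- s *\<^sub>R q + c *\<^sub>R q'"
  have "c *\<^sub>R ?r + (- s) *\<^sub>R ?r' = (c\<^sup>2 + s\<^sup>2) *\<^sub>R q"
    "- (- s) *\<^sub>R ?r + c *\<^sub>R ?r' = (c\<^sup>2 + s\<^sup>2) *\<^sub>R q'"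
    by (simp_all add: algebra_simps power2_eq_square)
  then show "oplane q q' \<subseteq> oplane ?r ?r'"
    using oplane_rotate_subset[of c "- s" ?r ?r'] assms by simp
qed (rule oplane_rotate_subset[OF assms])

lemma V_rotate:
  assumes V: "(q, q') \<in> V" and cs: "c\<^sup>2 + s\<^sup>2 = (1::real)"
  shows "(c *\<^sub>R q + s *\<^sub>R q', - s *\<^sub>R q + c *\<^sub>R q') \<in> V"
proof -
  have [simp]: "Bform q q' = 0" "Bform q' q = 0"
    using V_Bform[OF V] Bform_commute[of q' q] by simp_all
  note on = V_orthonormal[OF V]
  have "inner q' q = 0" using on by (simp add: inner_commute)
  then have "norm (c *\<^sub>R q + s *\<^sub>R q') = 1" "norm (- s *\<^sub>R q + c *\<^sub>R q') = 1"
    using on cs by (simp_all add: norm_eq_1 inner_add_left inner_add_right inner_diff_left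
        inner_diff_right power2_eq_square add.commute)
  moreover have "Bform (c *\<^sub>R q + s *\<^sub>R q') (- s *\<^sub>R q + c *\<^sub>R q') = 0"
    by (simp only: Bform_add_left Bform_add_right Bform_scaleR_left Bform_scaleR_right)
      (simp add: Bform_self V_norm[OF V])
  ultimately show ?thesis by (simp add: V_def)
qed

text \<open>Taking norms in \<open>x * qcnj x' = - (y' * qcnj y)\<close> gives \<open>|x| |x'| = |y| |y'|\<close>;
  with \<open>a = |x|\<^sup>2\<close> and \<open>b = |x'|\<^sup>2\<close> this reads \<open>a b = (1 - a) (1 - b)\<close>.\<close>

lemma V_norm_fst:
  assumes "(q, q') \<in> V"
  shows "(norm (fst q))\<^sup>2 + (norm (fst q'))\<^sup>2 = 1"
proof -
  have "fst q * qcnj (fst q') = - (snd q' * qcnj (snd q))"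
    using V_Bform[OF assms] by (simp add: Bform_def eq_neg_iff_add_eq_0)
  then have "norm (fst q) * norm (fst q') = norm (snd q') * norm (snd q)"
    by (metis norm_minus_cancel norm_mult norm_qcnj)
  then have "(norm (fst q))\<^sup>2 * (norm (fst q'))\<^sup>2 = (norm (snd q'))\<^sup>2 * (norm (snd q))\<^sup>2"
    by (metis power_mult_distrib)
  moreover have "(norm (snd q))\<^sup>2 = 1 - (norm (fst q))\<^sup>2" "(norm (snd q'))\<^sup>2 = 1 - (norm (fst q'))\<^sup>2"
    using V_norm[OF assms] norm_oct_square[of q] norm_oct_square[of q'] by simp_all
  ultimately show ?thesis by (simp add: algebra_simps)
qed

lemma V_defect_identity:
  assumes V: "(q, q') \<in> V"
  shows "((norm (fst q))\<^sup>2 - (norm (fst q'))\<^sup>2)\<^sup>2 + 4 * (inner (fst q) (fst q'))\<^sup>2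
         + 4 * (p (oplane q q'))\<^sup>2 = 1"
proof -
  have "(p (oplane q q'))\<^sup>2 = (norm (fst q))\<^sup>2 * (norm (fst q'))\<^sup>2 - (inner (fst q) (fst q'))\<^sup>2"
    by (simp only: p_oplane[OF V] norm_qIm_square qRe_mult_qcnj norm_mult norm_qcnj
        power_mult_distrib)
  moreover have "((norm (fst q))\<^sup>2 - (norm (fst q'))\<^sup>2)\<^sup>2 + 4 * ((norm (fst q))\<^sup>2 * (norm (fst q'))\<^sup>2)
      = ((norm (fst q))\<^sup>2 + (norm (fst q'))\<^sup>2)\<^sup>2" by algebra
  ultimately show ?thesis by (simp add: V_norm_fst[OF V])
qed

text \<open>The condition \<open>\<langle>w, w'\<rangle> = 0\<close> on a basis rotated by the angle \<open>t\<close> is linear in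
  \<open>(cos 2t, sin 2t)\<close>, hence solvable.\<close>

lemma rotate_to_orthogonal:
  fixes x x' :: "'a::real_inner"
  obtains c s where "c\<^sup>2 + s\<^sup>2 = (1::real)"
    "inner (c *\<^sub>R x + s *\<^sub>R x') (- s *\<^sub>R x + c *\<^sub>R x') = 0"
proof -
  define A where "A = inner x x'"
  define D where "D = (inner x' x' - inner x x) / 2"
  have "\<exists>C S. C\<^sup>2 + S\<^sup>2 = (1::real) \<and> C * A + S * D = 0"
  proof (cases "A\<^sup>2 + D\<^sup>2 = 0")
    case True
    then have "A = 0" "D = 0" by (simp_all add: sum_power2_eq_zero_iff)
    then show ?thesis by (intro exI[of _ 1] exI[of _ 0]) simp
  next
    case False
    define n where "n = sqrt (A\<^sup>2 + D\<^sup>2)"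
    have n: "n \<noteq> 0" "n\<^sup>2 = A\<^sup>2 + D\<^sup>2" using False by (simp_all add: n_def)
    have "(D / n)\<^sup>2 + (- A / n)\<^sup>2 = (A\<^sup>2 + D\<^sup>2) / n\<^sup>2"
      by (simp add: power_divide add_divide_distrib)
    also have "\<dots> = 1" using n(1) by (simp add: n(2)[symmetric])
    finally show ?thesis
      by (intro exI[of _ "D / n"] exI[of _ "- A / n"]) simp
  qed
  then obtain C S where CS: "C\<^sup>2 + S\<^sup>2 = (1::real)" "C * A + S * D = 0" by blast
  obtain t where t: "C = cos t" "S = sin t" using sincos_total_2pi[OF CS(1)] by blast
  define c s where "c = cos (t / 2)" and "s = sin (t / 2)"
  have double: "C = c\<^sup>2 - s\<^sup>2" "S = 2 * s * c"
    using cos_double[of "t / 2"] sin_double[of "t / 2"] by (simp_all add: t c_def s_def)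
  have "inner (c *\<^sub>R x + s *\<^sub>R x') (- s *\<^sub>R x + c *\<^sub>R x')
      = (c\<^sup>2 - s\<^sup>2) * inner x x' + c * s * (inner x' x' - inner x x)"
    by (simp add: inner_add_left inner_add_right inner_diff_left inner_diff_right
        inner_commute[of x' x] algebra_simps power2_eq_square)
  also have "\<dots> = C * A + S * D" by (simp add: double A_def D_def)
  finally show ?thesis using CS(2) by (intro that[of c s]) (simp_all add: c_def s_def)
qed

lemma Q_orthogonal_basis:
  assumes "P \<in> Q"
  obtains q q' where "(q, q') \<in> V" "P = oplane q q'" "inner (fst q) (fst q') = 0"
    "norm (fst q') \<le> norm (fst q)"
proof -
  obtain r r' where V: "(r, r') \<in> V" and P: "P = oplane r r'" using assms by (rule Q_cases)
  obtain c s where cs: "c\<^sup>2 + s\<^sup>2 = 1"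
    "inner (c *\<^sub>R fst r + s *\<^sub>R fst r') (- s *\<^sub>R fst r + c *\<^sub>R fst r') = 0"
    by (rule rotate_to_orthogonal)
  define q q' where "q = c *\<^sub>R r + s *\<^sub>R r'" and "q' = - s *\<^sub>R r + c *\<^sub>R r'"
  have q: "(q, q') \<in> V" "P = oplane q q'" "inner (fst q) (fst q') = 0"
    using V_rotate[OF V cs(1)] oplane_rotate[OF cs(1), of r r'] cs(2)
    by (simp_all add: q_def q'_def P)
  show ?thesis
  proof (cases "norm (fst q') \<le> norm (fst q)")
    case True
    with q show ?thesis by (rule that)
  next
    case False
    \<comment> \<open>A quarter turn replaces \<open>(q, q')\<close> by \<open>(q', - q)\<close>.\<close>
    have "(q', - q) \<in> V" "P = oplane q' (- q)"
      using V_rotate[OF q(1), of 0 1] oplane_rotate[of 0 1 q q'] q(2) by simp_all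
    then show ?thesis
      using False q(3) by (intro that[of q' "- q"]) (simp_all add: inner_commute)
  qed
qed

text \<open>Write \<open>x = \<alpha> u\<close>, \<open>x' = \<beta> v\<close>, \<open>y' = \<alpha> r\<close> with units \<open>u, v, r\<close>. The condition
  \<open>Bform q q' = 0\<close> then forces \<open>y = - \<beta> (v * qcnj u * r)\<close>. Orthogonality makes \<open>v * qcnj u\<close> an imaginary
  unit; if \<open>c\<close> conjugates it to \<open>-i\<close>, the right factors \<open>qcnj u * qcnj c\<close> and \<open>qcnj r * qcnj c\<close> cancel
  \<open>u\<close> and \<open>r\<close>, and all four components take their normal values at once.\<close>

lemma normalise_basis:
  assumes V: "(q, q') \<in> V" and orth: "inner (fst q) (fst q') = 0"
    and le: "norm (fst q') \<le> norm (fst q)"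
  defines "\<alpha> \<equiv> norm (fst q)" and "\<beta> \<equiv> norm (fst q')"
  obtains g where "g \<in> G" "g q = (\<alpha> *\<^sub>R 1, \<beta> *\<^sub>R quat_i)" "g q' = (- \<beta> *\<^sub>R quat_i, \<alpha> *\<^sub>R 1)"
proof -
  have ab: "\<alpha>\<^sup>2 + \<beta>\<^sup>2 = 1" using V_norm_fst[OF V] by (simp add: \<alpha>_def \<beta>_def)
  have "\<alpha> \<noteq> 0" using ab le by (auto simp: \<alpha>_def \<beta>_def)
  have "(norm (snd q'))\<^sup>2 = \<alpha>\<^sup>2"
    using norm_oct_square[of q'] V_norm[OF V] ab by (simp add: \<beta>_def)
  then have y': "norm (snd q') = \<alpha>" by (simp add: \<alpha>_def)
  obtain u where u: "norm u = 1" "fst q = \<alpha> *\<^sub>R u" unfolding \<alpha>_def by (rule unit_factor)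
  obtain r where r: "norm r = 1" "snd q' = \<alpha> *\<^sub>R r"
    using unit_factor[of "snd q'"] unfolding y' by blast
  obtain v where v: "norm v = 1" "fst q' = \<beta> *\<^sub>R v" "inner u v = 0"
  proof (cases "\<beta> = 0")
    \<comment> \<open>If \<open>x' = 0\<close>, every unit \<open>v\<close> orthogonal to \<open>u\<close> will do.\<close>
    case True
    show ?thesis
    proof (rule that)
      show "norm (quat_i * u) = 1" by (simp add: norm_mult u norm_quat_def[of quat_i] inner_quat_def)
      show "fst q' = \<beta> *\<^sub>R (quat_i * u)" using True by (simp add: \<beta>_def)
      show "inner u (quat_i * u) = 0" by (simp add: inner_quat_def)
    qed
  next
    case False
    obtain v where v: "norm v = 1" "fst q' = \<beta> *\<^sub>R v" unfolding \<beta>_def by (rule unit_factor)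
    with orth u(2) \<open>\<alpha> \<noteq> 0\<close> False show ?thesis by (intro that[of v]) simp_all
  qed
  have y: "snd q = - (\<beta> *\<^sub>R (v * qcnj u * r))"
  proof -
    have "\<alpha> *\<^sub>R (r * qcnj (snd q)) = - (\<alpha> *\<^sub>R (\<beta> *\<^sub>R (u * qcnj v)))"
      using V_Bform[OF V] by (simp add: Bform_def u(2) v(2) r(2) qcnj_scaleR add_eq_0_iff mult_ac)
    then have "\<alpha> *\<^sub>R (r * qcnj (snd q)) = \<alpha> *\<^sub>R (- (\<beta> *\<^sub>R (u * qcnj v)))" by simp
    then have "r * qcnj (snd q) = - (\<beta> *\<^sub>R (u * qcnj v))"
      using \<open>\<alpha> \<noteq> 0\<close> by (simp only: scaleR_cancel_left) simp
    then have "qcnj r * (r * qcnj (snd q)) = qcnj r * (- (\<beta> *\<^sub>R (u * qcnj v)))" by simp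
    then have "qcnj (snd q) = - (\<beta> *\<^sub>R (qcnj r * (u * qcnj v)))" by (simp add: unit_cancel r(1))
    then have "qcnj (qcnj (snd q)) = qcnj (- (\<beta> *\<^sub>R (qcnj r * (u * qcnj v))))" by simp
    then show ?thesis by (simp add: qcnj_minus qcnj_scaleR qcnj_mult mult.assoc)
  qed
  have "norm (v * qcnj u) = 1" "qRe (v * qcnj u) = 0"
    using u v by (simp add: norm_mult) (simp only: qRe_mult_qcnj inner_commute[of v u] v(3))
  then obtain c where c: "norm c = 1" "c * (v * qcnj u) * qcnj c = - quat_i"
    by (rule imaginary_unit_conjugate)
  define g where "g = (\<lambda>(x, y). (c * x * (qcnj u * qcnj c), c * y * (qcnj r * qcnj c)))"
  have "g \<in> G"
    unfolding g_def by (rule two_sided_multiplication_G) (simp_all add: norm_mult c u r)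
  moreover have "c * fst q * (qcnj u * qcnj c) = \<alpha> *\<^sub>R 1"
    "c * snd q' * (qcnj r * qcnj c) = \<alpha> *\<^sub>R 1"
    by (simp_all add: u r mult.assoc unit_cancel unit_mult_qcnj c)
  moreover have "c * fst q' * (qcnj u * qcnj c) = - \<beta> *\<^sub>R quat_i"
    "c * snd q * (qcnj r * qcnj c) = \<beta> *\<^sub>R quat_i"
    using c(2) by (simp_all add: v(2) y mult.assoc unit_cancel r)
  ultimately show ?thesis by (intro that[of g]) (simp_all add: g_def case_prod_beta)
qed

text \<open>The numbers \<open>\<alpha>\<close> and \<open>\<beta>\<close> solve \<open>\<alpha>\<^sup>2 + \<beta>\<^sup>2 = 1\<close>, \<open>\<alpha> \<beta> = t\<close>, that is
  \<open>(\<alpha> \<plusminus> \<beta>)\<^sup>2 = 1 \<plusminus> 2 t\<close>.\<close>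

definition normal_plane :: "real \<Rightarrow> (oct \<times> oct) set" where
  "normal_plane t =
    (let \<alpha> = (sqrt (1 + 2 * t) + sqrt (1 - 2 * t)) / 2;
         \<beta> = (sqrt (1 + 2 * t) - sqrt (1 - 2 * t)) / 2
     in oplane (\<alpha> *\<^sub>R 1, \<beta> *\<^sub>R quat_i) (- \<beta> *\<^sub>R quat_i, \<alpha> *\<^sub>R 1))"

lemma normal_basis:
  assumes "\<alpha>\<^sup>2 + \<beta>\<^sup>2 = 1" "0 \<le> \<alpha> * \<beta>"
  shows "((\<alpha> *\<^sub>R 1, \<beta> *\<^sub>R quat_i), (- \<beta> *\<^sub>R quat_i, \<alpha> *\<^sub>R 1)) \<in> V"
    and "p (oplane (\<alpha> *\<^sub>R 1, \<beta> *\<^sub>R quat_i) (- \<beta> *\<^sub>R quat_i, \<alpha> *\<^sub>R 1)) = \<alpha> * \<beta>"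
proof -
  show V: "((\<alpha> *\<^sub>R 1, \<beta> *\<^sub>R quat_i), (- \<beta> *\<^sub>R quat_i, \<alpha> *\<^sub>R 1)) \<in> V"
    using assms(1) by (simp add: V_def norm_eq_1 inner_oct inner_quat_def Bform_def quat_eq_iff
        power2_eq_square add.commute)
  have "qIm (\<alpha> *\<^sub>R 1 * qcnj (- \<beta> *\<^sub>R quat_i)) = (\<alpha> * \<beta>) *\<^sub>R quat_i"
    by (simp add: quat_eq_iff)
  moreover have "norm quat_i = 1" by (simp add: norm_quat_def inner_quat_def)
  ultimately show "p (oplane (\<alpha> *\<^sub>R 1, \<beta> *\<^sub>R quat_i) (- \<beta> *\<^sub>R quat_i, \<alpha> *\<^sub>R 1)) = \<alpha> * \<beta>"
    unfolding p_oplane[OF V] fst_conv using assms(2) by simp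
qed

lemma normal_plane:
  assumes "t \<in> {0..1/2}"
  shows "normal_plane t \<in> Q" "p (normal_plane t) = t"
proof -
  define \<alpha> \<beta> where "\<alpha> = (sqrt (1 + 2 * t) + sqrt (1 - 2 * t)) / 2"
    and "\<beta> = (sqrt (1 + 2 * t) - sqrt (1 - 2 * t)) / 2"
  have sq: "(sqrt (1 + 2 * t))\<^sup>2 = 1 + 2 * t" "(sqrt (1 - 2 * t))\<^sup>2 = 1 - 2 * t"
    using assms by simp_all
  have "\<alpha>\<^sup>2 + \<beta>\<^sup>2 = ((sqrt (1 + 2 * t))\<^sup>2 + (sqrt (1 - 2 * t))\<^sup>2) / 2"
    unfolding \<alpha>_def \<beta>_def by (simp add: field_simps power2_eq_square)
  then have 1: "\<alpha>\<^sup>2 + \<beta>\<^sup>2 = 1" unfolding sq by simp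
  have "\<alpha> * \<beta> = ((sqrt (1 + 2 * t))\<^sup>2 - (sqrt (1 - 2 * t))\<^sup>2) / 4"
    unfolding \<alpha>_def \<beta>_def by (simp add: field_simps power2_eq_square)
  then have 2: "\<alpha> * \<beta> = t" unfolding sq by simp
  have "normal_plane t = oplane (\<alpha> *\<^sub>R 1, \<beta> *\<^sub>R quat_i) (- \<beta> *\<^sub>R quat_i, \<alpha> *\<^sub>R 1)"
    by (simp add: normal_plane_def Let_def \<alpha>_def \<beta>_def)
  then show "normal_plane t \<in> Q" "p (normal_plane t) = t"
    using normal_basis[of \<alpha> \<beta>] 1 2 assms by (auto simp: Q_def)
qed

lemma act_to_normal_plane:
  assumes "P \<in> Q"
  obtains g where "g \<in> G" "act g P = normal_plane (p P)"
proof -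
  obtain q q' where V: "(q, q') \<in> V" and P: "P = oplane q q'"
    and q: "inner (fst q) (fst q') = 0" "norm (fst q') \<le> norm (fst q)"
    using assms by (rule Q_orthogonal_basis)
  define \<alpha> \<beta> where "\<alpha> = norm (fst q)" and "\<beta> = norm (fst q')"
  obtain g where g: "g \<in> G" "g q = (\<alpha> *\<^sub>R 1, \<beta> *\<^sub>R quat_i)" "g q' = (- \<beta> *\<^sub>R quat_i, \<alpha> *\<^sub>R 1)"
    using normalise_basis[OF V q] unfolding \<alpha>_def \<beta>_def by blast
  have "\<alpha>\<^sup>2 + \<beta>\<^sup>2 = 1" using V_norm_fst[OF V] by (simp add: \<alpha>_def \<beta>_def)
  moreover have "p P = \<alpha> * \<beta>"
    unfolding P p_oplane[OF V] using q(1)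
    by (simp only: qIm_eq_self qRe_mult_qcnj norm_mult norm_qcnj \<alpha>_def \<beta>_def)
  ultimately have "1 + 2 * p P = (\<alpha> + \<beta>)\<^sup>2" "1 - 2 * p P = (\<alpha> - \<beta>)\<^sup>2"
    by (simp_all add: power2_sum power2_diff)
  moreover have "\<alpha> + \<beta> \<ge> 0" "\<alpha> - \<beta> \<ge> 0" using q(2) by (simp_all add: \<alpha>_def \<beta>_def)
  ultimately have "sqrt (1 + 2 * p P) = \<alpha> + \<beta>" "sqrt (1 - 2 * p P) = \<alpha> - \<beta>" by simp_all
  then have "normal_plane (p P) = act g P"
    by (simp add: normal_plane_def P G_act_oplane[OF g(1)] g(2,3))
  with g(1) show ?thesis by (intro that) simp_all
qed

lemma orbit_eq_fibre:
  assumes P: "P \<in> Q"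
  shows "orbit P = {P' \<in> Q. p P' = p P}"
proof
  show "orbit P \<subseteq> {P' \<in> Q. p P' = p P}"
    using P by (auto simp: orbit_def act_Q p_act)
  show "{P' \<in> Q. p P' = p P} \<subseteq> orbit P"
  proof
    fix P' assume "P' \<in> {P' \<in> Q. p P' = p P}"
    then have P': "P' \<in> Q" "p P' = p P" by simp_all
    obtain g where g: "g \<in> G" "act g P = normal_plane (p P)"
      using P by (rule act_to_normal_plane)
    obtain h where h: "h \<in> G" "act h P' = normal_plane (p P)"
      using act_to_normal_plane[OF P'(1)] P'(2) by metis
    have "act (inv h \<circ> g) P = P'"
      by (metis act_comp act_inv_act g(2) h)
    then show "P' \<in> orbit P" unfolding orbit_def using G_comp[OF G_inv[OF h(1)] g(1)] by blast
  qed
qed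


section \<open>The fibres in terms of the first components\<close>

text \<open>If \<open>x * qcnj x'\<close> is real, multiplying it by \<open>x'\<close> from the right gives a linear relation, which is
  nontrivial unless \<open>x' = 0\<close>. Conversely, \<open>qIm (z * qcnj z) = 0\<close> turns a relation \<open>a x + b x' = 0\<close>
  into \<open>a qIm (x * qcnj x') = b qIm (x * qcnj x') = 0\<close>.\<close>

lemma qIm_mult_qcnj_eq_0_iff: "qIm (x * qcnj x') = 0 \<longleftrightarrow> \<not> lin_indep_pair x x'"
proof
  assume "qIm (x * qcnj x') = 0"
  then have "x * qcnj x' = qRe (x * qcnj x') *\<^sub>R 1"
    by (rule real_quat)
  then have "x * qcnj x' = inner x x' *\<^sub>R 1"
    by (simp only: qRe_mult_qcnj)
  then have "x * (qcnj x' * x') = inner x x' *\<^sub>R x'"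
    by (simp add: mult.assoc[symmetric])
  then have dep: "inner x' x' *\<^sub>R x + (- inner x x') *\<^sub>R x' = 0"
    by (simp add: quat_mult_cnj)
  show "\<not> lin_indep_pair x x'"
  proof (cases "x' = 0")
    case True
    then have "0 *\<^sub>R x + 1 *\<^sub>R x' = 0" by simp
    then show ?thesis unfolding lin_indep_pair_def by (metis zero_neq_one)
  next
    case False
    with dep show ?thesis unfolding lin_indep_pair_def by (metis inner_eq_zero_iff)
  qed
next
  assume "\<not> lin_indep_pair x x'"
  then obtain a b where ab: "a *\<^sub>R x + b *\<^sub>R x' = 0" "a \<noteq> 0 \<or> b \<noteq> 0"
    unfolding lin_indep_pair_def by blast
  have real: "qIm (z * qcnj z) = 0" for z by (simp add: quat_mult_cnj quat_eq_iff)
  have "a *\<^sub>R qIm (x * qcnj x') = qIm ((a *\<^sub>R x + b *\<^sub>R x') * qcnj x') - b *\<^sub>R qIm (x' * qcnj x')"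
    by (simp add: quat_eq_iff algebra_simps)
  moreover have "b *\<^sub>R qIm (x * qcnj x') = qIm (x * qcnj (a *\<^sub>R x + b *\<^sub>R x')) - a *\<^sub>R qIm (x * qcnj x)"
    by (simp add: quat_eq_iff algebra_simps)
  ultimately have "a *\<^sub>R qIm (x * qcnj x') = 0" "b *\<^sub>R qIm (x * qcnj x') = 0"
    unfolding ab(1) real by (simp_all add: quat_eq_iff)
  with ab(2) show "qIm (x * qcnj x') = 0" by auto
qed

lemma p_eq_0_iff:
  assumes "(q, q') \<in> V"
  shows "p (oplane q q') = 0 \<longleftrightarrow> \<not> lin_indep_pair (fst q) (fst q')"
  by (simp add: p_oplane[OF assms] qIm_mult_qcnj_eq_0_iff)

lemma p_nonneg: "P \<in> Q \<Longrightarrow> 0 \<le> p P"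
  by (erule Q_cases) (simp add: p_oplane)

lemma p_le_half:
  assumes "P \<in> Q"
  shows "p P \<le> 1/2"
proof -
  obtain q q' where V: "(q, q') \<in> V" and P: "P = oplane q q'" using assms by (rule Q_cases)
  have "4 * (p P)\<^sup>2 \<le> 1"
    using V_defect_identity[OF V] zero_le_power2[of "inner (fst q) (fst q')"]
      zero_le_power2[of "(norm (fst q))\<^sup>2 - (norm (fst q'))\<^sup>2"]
    unfolding P by linarith
  then have "(p P)\<^sup>2 \<le> (1/2)\<^sup>2" by (simp add: power_divide)
  then show ?thesis by (rule power2_le_imp_le) simp
qed

lemma p_eq_half_iff:
  assumes V: "(q, q') \<in> V"
  shows "p (oplane q q') = 1/2 \<longleftrightarrow>
    inner (fst q) (fst q') = 0 \<and> norm (fst q') - norm (fst q) = 0"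
proof -
  have "p (oplane q q') \<ge> 0" by (rule p_nonneg[OF oplane_Q[OF V]])
  then have "p (oplane q q') = 1/2 \<longleftrightarrow> (p (oplane q q'))\<^sup>2 = (1/2)\<^sup>2"
    by (subst power2_eq_iff_nonneg) simp_all
  also have "\<dots> \<longleftrightarrow> ((norm (fst q))\<^sup>2 - (norm (fst q'))\<^sup>2)\<^sup>2 + (2 * inner (fst q) (fst q'))\<^sup>2 = 0"
    using V_defect_identity[OF V] by (auto simp: power_divide power_mult_distrib)
  also have "\<dots> \<longleftrightarrow> (norm (fst q))\<^sup>2 = (norm (fst q'))\<^sup>2 \<and> inner (fst q) (fst q') = 0"
    unfolding sum_power2_eq_zero_iff by simp
  also have "\<dots> \<longleftrightarrow> inner (fst q) (fst q') = 0 \<and> norm (fst q') - norm (fst q) = 0"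
    by auto
  finally show ?thesis .
qed

lemma P1_normal: "P1 = normal_plane 0"
proof -
  have "((- 0) *\<^sub>R quat_i :: quat) = 0" by simp
  then show ?thesis by (simp add: P1_def normal_plane_def)
qed

lemma P2_normal: "P2 = normal_plane (1/2)"
proof -
  have half: "1 / sqrt 2 = sqrt 2 / 2" by (simp add: field_simps)
  show ?thesis unfolding P2_def normal_plane_def Let_def half by simp
qed

lemma Q_filter_eq:
  assumes "\<And>q q'. (q, q') \<in> V \<Longrightarrow> \<phi> (oplane q q') \<longleftrightarrow> \<psi> q q'"
  shows "{P \<in> Q. \<phi> P} = {oplane q q' | q q'. (q, q') \<in> V \<and> \<psi> q q'}"
  using assms unfolding Q_def by blast

lemma open_fibres_eq_U: "{P \<in> Q. p P \<in> {0<..<1/2}} = U"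
  unfolding U_def
proof (rule Q_filter_eq)
  fix q q' assume V: "(q, q') \<in> V"
  then have "oplane q q' \<in> Q" by (rule oplane_Q)
  then have "p (oplane q q') \<in> {0<..<1/2} \<longleftrightarrow> p (oplane q q') \<noteq> 0 \<and> p (oplane q q') \<noteq> 1/2"
    using p_nonneg[of "oplane q q'"] p_le_half[of "oplane q q'"] by auto
  also have "\<dots> \<longleftrightarrow> lin_indep_pair (fst q) (fst q') \<and>
      \<not> (inner (fst q) (fst q') = 0 \<and> norm (fst q') - norm (fst q) = 0)"
    unfolding p_eq_0_iff[OF V] p_eq_half_iff[OF V] by blast
  also have "\<dots> \<longleftrightarrow> lin_indep_pair (fst q) (fst q') \<and>
      \<bar>inner (fst q) (fst q')\<bar> + \<bar>norm (fst q) - norm (fst q')\<bar> \<noteq> 0"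
    by auto
  finally show "p (oplane q q') \<in> {0<..<1/2} \<longleftrightarrow> lin_indep_pair (fst q) (fst q') \<and>
      \<bar>inner (fst q) (fst q')\<bar> + \<bar>norm (fst q) - norm (fst q')\<bar> \<noteq> 0" .
qed

theorem mainTheorem4:
  shows "p \<in> Q \<rightarrow> {0..1/2}
    \<and> {orbit P | P. P \<in> Q} = {{P \<in> Q. p P = t} | t. t \<in> {0..1/2}}
    \<and> ({P \<in> Q. p P = 0} = orbit P1
       \<and> orbit P1 = {oplane q q' | q q'. (q, q') \<in> V \<and> \<not> lin_indep_pair (fst q) (fst q')})
    \<and> ({P \<in> Q. p P = 1/2} = orbit P2
       \<and> orbit P2 = {oplane q q' | q q'. (q, q') \<in> V \<and>
            inner (fst q) (fst q') = 0 \<and> norm (fst q') - norm (fst q) = 0})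
    \<and> ({P \<in> Q. p P \<in> {0<..<1/2}} = U
       \<and> (\<forall>P\<in>U. \<forall>P'\<in>U. p P = p P' \<longleftrightarrow> orbit P = orbit P'))"
proof (intro conjI ballI)
  show "p \<in> Q \<rightarrow> {0..1/2}"
    using p_nonneg p_le_half by auto
  show "{orbit P | P. P \<in> Q} = {{P \<in> Q. p P = t} | t. t \<in> {0..1/2}}"
  proof (intro equalityI subsetI)
    fix X assume "X \<in> {orbit P | P. P \<in> Q}"
    then obtain P where P: "P \<in> Q" "X = {P' \<in> Q. p P' = p P}"
      using orbit_eq_fibre by auto
    then have "p P \<in> {0..1/2}" using p_nonneg p_le_half by auto
    with P(2) show "X \<in> {{P \<in> Q. p P = t} | t. t \<in> {0..1/2}}" by blast
  next
    fix X assume "X \<in> {{P \<in> Q. p P = t} | t. t \<in> {0..1/2}}"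
    then obtain t where t: "t \<in> {0..1/2}" "X = {P \<in> Q. p P = t}" by blast
    then have "X = orbit (normal_plane t)"
      using orbit_eq_fibre[OF normal_plane(1)[OF t(1)]] normal_plane(2)[OF t(1)] by simp
    then show "X \<in> {orbit P | P. P \<in> Q}" using normal_plane(1)[OF t(1)] by blast
  qed
  show 0: "{P \<in> Q. p P = 0} = orbit P1"
    using orbit_eq_fibre[OF normal_plane(1)] normal_plane(2) by (simp add: P1_normal)
  show "orbit P1 = {oplane q q' | q q'. (q, q') \<in> V \<and> \<not> lin_indep_pair (fst q) (fst q')}"
    unfolding 0[symmetric] by (rule Q_filter_eq) (rule p_eq_0_iff)
  show half: "{P \<in> Q. p P = 1/2} = orbit P2"
    using orbit_eq_fibre[OF normal_plane(1)] normal_plane(2) by (simp add: P2_normal)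
  show "orbit P2 = {oplane q q' | q q'. (q, q') \<in> V \<and>
            inner (fst q) (fst q') = 0 \<and> norm (fst q') - norm (fst q) = 0}"
    unfolding half[symmetric] by (rule Q_filter_eq) (rule p_eq_half_iff)
  show "{P \<in> Q. p P \<in> {0<..<1/2}} = U" by (rule open_fibres_eq_U)
  show "p P = p P' \<longleftrightarrow> orbit P = orbit P'" if "P \<in> U" "P' \<in> U" for P P'
  proof -
    have "P \<in> Q" "P' \<in> Q" using that by (auto simp: open_fibres_eq_U[symmetric])
    then show ?thesis by (auto simp: orbit_eq_fibre)
  qed
qed

end
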